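(* Let $a,b,c$ be nonzero real numbers with $\Delta:=a^{2}b^{2}+4abc\neq 0$, and let $w_0,w_1$ be arbitrary. Let $\{w_n\}$ be defined by $w_n=aw_{n-1}+cw_{n-2}$ if $n$ is even and $w_n=bw_{n-1}+cw_{n-2}$ if $n$ is odd ($n\ge 2$). Let $\alpha=\frac{ab+\sqrt{\Delta}}{2}$, $\beta=\frac{ab-\sqrt{\Delta}}{2}$ (the roots of $x^2-abx-abc$), and put $A:=\frac{w_1-\frac{\beta}{a}w_0}{\alpha-\beta}$, $B:=\frac{w_1-\frac{\alpha}{a}w_0}{\alpha-\beta}$. Then for every integer $n>0$, $$w_n=\frac{a^{\xi(n+1)}}{(ab)^{\lfloor n/2\rfloor}}\left(A\alpha^{n}-B\beta^{n}\right).$$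
   Context: $\xi(n)=n-2\lfloor n/2\rfloor$ is the parity function ($\xi(n)=0$ for $n$ even, $1$ for $n$ odd). The sequence $\{w_n\}$ is called the generalized bi-periodic Horadam sequence. *)

theory Defs
  imports Complex_Main
begin

definition parity_fn :: "nat \<Rightarrow> nat" where
  "parity_fn n = n - 2 * (n div 2)"

fun horadam :: "'a::semiring_1 \<Rightarrow> 'a \<Rightarrow> 'a \<Rightarrow> 'a \<Rightarrow> 'a \<Rightarrow> nat \<Rightarrow> 'a" where
  "horadam a b c w0 w1 0 = w0"
| "horadam a b c w0 w1 (Suc 0) = w1"
| "horadam a b c w0 w1 (Suc (Suc n)) =
     (if even (Suc (Suc n)) then a else b) * horadam a b c w0 w1 (Suc n)
     + c * horadam a b c w0 w1 n"

definition horadam_disc :: "real \<Rightarrow> real \<Rightarrow> real \<Rightarrow> real" where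
  "horadam_disc a b c = a ^ 2 * b ^ 2 + 4 * a * b * c"

text \<open>The discriminant may be negative, so the two roots are complex numbers and the
  square root is the principal complex one; for a nonnegative discriminant
  it is the usual real square root.\<close>

definition horadam_alpha :: "real \<Rightarrow> real \<Rightarrow> real \<Rightarrow> complex" where
  "horadam_alpha a b c =
     (of_real a * of_real b + csqrt (of_real (horadam_disc a b c))) / 2"

definition horadam_beta :: "real \<Rightarrow> real \<Rightarrow> real \<Rightarrow> complex" where
  "horadam_beta a b c =
     (of_real a * of_real b - csqrt (of_real (horadam_disc a b c))) / 2"

definition horadam_A :: "real \<Rightarrow> real \<Rightarrow> real \<Rightarrow> complex \<Rightarrow> complex \<Rightarrow> complex" where
  "horadam_A a b c w0 w1 =
     (w1 - horadam_beta a b c / of_real a * w0)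
     / (horadam_alpha a b c - horadam_beta a b c)"

definition horadam_B :: "real \<Rightarrow> real \<Rightarrow> real \<Rightarrow> complex \<Rightarrow> complex \<Rightarrow> complex" where
  "horadam_B a b c w0 w1 =
     (w1 - horadam_alpha a b c / of_real a * w0)
     / (horadam_alpha a b c - horadam_beta a b c)"

lemma horadam_roots:
  "x ^ 2 - of_real (a * b) * x - of_real (a * b * c)
     = (x - horadam_alpha a b c) * (x - horadam_beta a b c)"
proof -
  define s where "s = csqrt (of_real (horadam_disc a b c))"
  have s: "s * s = of_real (a ^ 2 * b ^ 2 + 4 * a * b * c)"
    by (metis s_def horadam_disc_def power2_csqrt power2_eq_square)
  have "(x - (of_real a * of_real b + s) / 2) * (x - (of_real a * of_real b - s) / 2)
     = x ^ 2 - of_real (a * b) * x + (of_real (a ^ 2 * b ^ 2) - s * s) / 4"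
    by (simp add: field_simps power2_eq_square)
  then show ?thesis
    unfolding horadam_alpha_def horadam_beta_def s_def[symmetric] s
    by simp
qed

end

theory Submission
  imports Defs
begin

text \<open>The factor \<open>a ^ parity_fn (n + 1) / (a * b) ^ (n div 2)\<close> turns the two alternating
  recurrences into the single recurrence \<open>u (n + 2) = a * b * (u (n + 1) + c * u n)\<close>, whose
  characteristic roots are \<open>\<alpha>\<close> and \<open>\<beta>\<close>.\<close>

lemma parity_fn_eq_mod: "parity_fn n = n mod 2"
  by (simp add: parity_fn_def minus_mult_div_eq_mod)

text \<open>The sequence \<open>u\<close> is left abstract, so any solution of the single recurrence
  with these initial values will do. The condition \<open>a * u 0 = w0\<close> reflects that the
  factor equals \<open>a\<close> at index 0 and 1 at index 1.\<close>

lemma horadam_eq_rescaled: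
  fixes a b c w0 w1 :: "'a::field" and u :: "nat \<Rightarrow> 'a"
  assumes nz: "a \<noteq> 0" "b \<noteq> 0"
    and u0: "a * u 0 = w0" and u1: "u 1 = w1"
    and rec: "\<And>n. u (Suc (Suc n)) = a * b * (u (Suc n) + c * u n)"
  shows "horadam a b c w0 w1 n = a ^ parity_fn (n + 1) / (a * b) ^ (n div 2) * u n"
proof -
  \<comment> \<open>The factor is \<open>a / (a * b) ^ k\<close> at index \<open>2 * k\<close> and
    \<open>1 / (a * b) ^ k\<close> at the next one. Both cases go through one induction, since each
    new term needs the two before it.\<close>
  have *: "horadam a b c w0 w1 (2 * k) = a / (a * b) ^ k * u (2 * k) \<and>
    horadam a b c w0 w1 (Suc (2 * k)) = u (Suc (2 * k)) / (a * b) ^ k" for k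
  proof (induction k)
    case 0
    show ?case using u0 u1 by simp
  next
    case (Suc k)
    then have IH: "horadam a b c w0 w1 (2 * k) = a / (a * b) ^ k * u (2 * k)"
      "horadam a b c w0 w1 (Suc (2 * k)) = u (Suc (2 * k)) / (a * b) ^ k"
      by blast+
    have "horadam a b c w0 w1 (Suc (Suc (2 * k)))
      = a * horadam a b c w0 w1 (Suc (2 * k)) + c * horadam a b c w0 w1 (2 * k)"
      by simp
    also have "\<dots> = a / (a * b) ^ Suc k * u (Suc (Suc (2 * k)))"
      unfolding IH rec[of "2 * k"] using nz by (simp add: field_simps)
    finally have even: "horadam a b c w0 w1 (Suc (Suc (2 * k)))
      = a / (a * b) ^ Suc k * u (Suc (Suc (2 * k)))" .
    have "horadam a b c w0 w1 (Suc (Suc (Suc (2 * k))))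
      = b * horadam a b c w0 w1 (Suc (Suc (2 * k))) + c * horadam a b c w0 w1 (Suc (2 * k))"
      by simp
    \<comment> \<open>Here \<open>b\<close> meets the extra \<open>a\<close> of the even term, and
      \<open>a * b\<close> cancels one power of the denominator; both summands then share the
      denominator \<open>(a * b) ^ k\<close>.\<close>
    also have "\<dots> = u (Suc (Suc (Suc (2 * k)))) / (a * b) ^ Suc k"
      unfolding even IH rec[of "Suc (2 * k)"] using nz by (simp add: field_simps)
    finally show ?case using even by simp
  qed
  show ?thesis
  proof (cases "even n")
    case True
    then obtain k where "n = 2 * k" by blast
    then show ?thesis using *[of k] by (simp add: parity_fn_eq_mod)
  next
    case False
    then obtain k where "n = Suc (2 * k)" by (metis oddE Suc_eq_plus1)
    then show ?thesis using *[of k] by (simp add: parity_fn_eq_mod)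
  qed
qed

text \<open>Multiply the quadratic equation satisfied by the root by \<open>x ^ n\<close>.\<close>

lemma horadam_root_power_rec:
  assumes "x = horadam_alpha a b c \<or> x = horadam_beta a b c"
  shows "x ^ Suc (Suc n) = of_real a * of_real b * (x ^ Suc n + of_real c * x ^ n)"
proof -
  have "x ^ 2 - of_real (a * b) * x - of_real (a * b * c) = 0"
    using assms unfolding horadam_roots by auto
  then have "x * x = of_real a * of_real b * (x + of_real c)"
    by (simp add: power2_eq_square algebra_simps)
  then have "x * x * x ^ n = of_real a * of_real b * (x + of_real c) * x ^ n"
    by simp
  then show ?thesis by (simp add: algebra_simps)
qed

theorem theorem1:
  fixes a b c :: real and w0 w1 :: complex and n :: nat
  assumes "a \<noteq> 0" and "b \<noteq> 0" and "c \<noteq> 0"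
    and "horadam_disc a b c \<noteq> 0"
    and "n > 0"
  shows "horadam (of_real a) (of_real b) (of_real c) w0 w1 n =
    of_real a ^ parity_fn (n + 1) / (of_real a * of_real b) ^ (n div 2)
    * (horadam_A a b c w0 w1 * horadam_alpha a b c ^ n
       - horadam_B a b c w0 w1 * horadam_beta a b c ^ n)"
proof (rule horadam_eq_rescaled)
  \<comment> \<open>The rule is applied with \<open>u m\<close> equal to
    \<open>A * \<alpha> ^ m - B * \<beta> ^ m\<close>; two initial values and the recurrence
    remain.\<close>
  let ?\<alpha> = "horadam_alpha a b c" and ?\<beta> = "horadam_beta a b c"
  have "?\<alpha> - ?\<beta> = csqrt (of_real (horadam_disc a b c))"
    by (simp add: horadam_alpha_def horadam_beta_def field_simps)
  then have ne: "?\<alpha> - ?\<beta> \<noteq> 0" using assms(4) by simp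
  \<comment> \<open>The \<open>w1\<close> terms cancel in \<open>A - B\<close>, which leaves
    \<open>w0 / a\<close>.\<close>
  show "of_real a * (horadam_A a b c w0 w1 * ?\<alpha> ^ 0 - horadam_B a b c w0 w1 * ?\<beta> ^ 0) = w0"
    using ne assms(1)
    by (simp add: horadam_A_def horadam_B_def diff_divide_distrib[symmetric])
      (simp add: field_simps)
  \<comment> \<open>Both products contain the same \<open>w0\<close> term, with coefficient
    \<open>\<alpha> * \<beta> / a\<close> in the numerator, so it cancels.\<close>
  have "horadam_A a b c w0 w1 * ?\<alpha> ^ 1 - horadam_B a b c w0 w1 * ?\<beta> ^ 1
    = w1 * (?\<alpha> - ?\<beta>) / (?\<alpha> - ?\<beta>)"
    unfolding horadam_A_def horadam_B_def
    by (simp add: diff_divide_distrib[symmetric] algebra_simps)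
  then show "horadam_A a b c w0 w1 * ?\<alpha> ^ 1 - horadam_B a b c w0 w1 * ?\<beta> ^ 1 = w1"
    using ne by simp
  \<comment> \<open>The recurrence is linear, so it passes from the powers of both roots to their
    combination.\<close>
  show "horadam_A a b c w0 w1 * ?\<alpha> ^ Suc (Suc m) - horadam_B a b c w0 w1 * ?\<beta> ^ Suc (Suc m)
    = of_real a * of_real b
      * ((horadam_A a b c w0 w1 * ?\<alpha> ^ Suc m - horadam_B a b c w0 w1 * ?\<beta> ^ Suc m)
         + of_real c * (horadam_A a b c w0 w1 * ?\<alpha> ^ m - horadam_B a b c w0 w1 * ?\<beta> ^ m))" for m
    unfolding horadam_root_power_rec[OF disjI1[OF refl], of a b c m]
      horadam_root_power_rec[OF disjI2[OF refl], of a b c m]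
    by (simp only: algebra_simps)
qed (use assms in auto)

end
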